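(* Let $\xi,\zeta\in[-1,1]$, $\gamma\in[0,1]$, $u\in[-1,1]$ and let $a_x,a_z,b_x,b_z$ be real numbers (SPAM parameters). Set $(\eta_x,t_x)=(\zeta\sqrt{1-\gamma},\,0)$ and $(\eta_z,t_z)=(\xi(1-\gamma),\,\xi\gamma u)$. For $\alpha\in\{0,1,+,-\}$ let $h(+)=h(-)=x$, $h(0)=h(1)=z$, $s(+)=s(0)=+1$, $s(-)=s(1)=-1$, and write $h=h(\alpha)$, $s=s(\alpha)$. Define $r_0=s$, $r_{N+1}=t_h+\eta_h r_N$, and $$\overline p_{N,\alpha}=\frac{1-s\,(a_h r_N+b_h)}{2}\qquad(N\ge0).$$ Assume $\eta_h\ne1$ and define $$\varepsilon_\alpha=\frac{1-\eta_h-s\,[a_ht_h+(1-\eta_h)b_h]}{2},\qquad a_\alpha=\frac{\varepsilon_\alpha}{1-\eta_h},\qquad b_\alpha=\overline p_{0,\alpha}-a_\alpha,$$ and assume $a_\alpha\neq0$. Then: (i) (three-parameter model) for all $N\ge0$, $$\overline p_{N,\alpha}=a_\alpha+b_\alpha\Bigl(1-\frac{\varepsilon_\alpha}{a_\alpha}\Bigr)^N .$$ (ii) (no SPAM) if $a_h=1$ and $b_h=0$, then $b_\alpha=-a_\alpha$, so that $\overline p_{N,\alpha}=a_\alpha\bigl(1-(1-\varepsilon_\alpha/a_\alpha)^N\bigr)$ for all $N\ge0$. (iii) (no SPAM and unital) if $a_h=1$, $b_h=0$ and $\gamma=0$, then $a_\alpha=\tfrac12$, so that $\overline p_{N,\alpha}=\tfrac12\bigl(1-(1-2\varepsilon_\alpha)^N\bigr)$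 for all $N\ge0$.
   Context: This models a logical qubit subject to the same (cycle-independent) channel in each quantum error correction cycle: generalized amplitude damping with strength $\gamma$ and equilibrium $z$-polarization $u$, followed by independent Pauli $X$ flips (probability $p_x$) and $Z$ flips (probability $p_z$), where $\xi=1-2p_x$ and $\zeta=1-2p_z$. The number $r_N$ is the true Bloch component along axis $h(\alpha)\in\{x,z\}$ after $N$ cycles starting from the state $|\alpha\rangle$; $a_hr_N+b_h$ is the observed value, distorted by state preparation and measurement (SPAM) errors; $\overline p_{N,\alpha}$ is the observed probability of a logical error after $N$ cycles; "no SPAM" means $a_h=1,b_h=0$, and "unital" means that the channel consists only of Pauli errors, i.e. $\gamma=0$. Convention: $0^0=1$. Note that $a_x,a_z,b_x,b_z$ (SPAM parameters, indexed by axis) are distinct from the fit parameters $a_\alpha,b_\alpha$ (indexed by the initial state $\alpha$). *)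

theory Defs
  imports Complex_Main
begin

datatype axis = AxisX | AxisZ

datatype logical_state = Ket0 | Ket1 | KetPlus | KetMinus

fun axis_of :: "logical_state \<Rightarrow> axis" where
  "axis_of KetPlus = AxisX"
| "axis_of KetMinus = AxisX"
| "axis_of Ket0 = AxisZ"
| "axis_of Ket1 = AxisZ"

fun sign_of :: "logical_state \<Rightarrow> real" where
  "sign_of KetPlus = 1"
| "sign_of Ket0 = 1"
| "sign_of KetMinus = - 1"
| "sign_of Ket1 = - 1"

text \<open>
  One cycle is generalized amplitude damping (strength \<open>\<gamma>\<close>, equilibrium polarization \<open>u\<close>)
  followed by independent Pauli X and Z flips, with \<open>\<xi> = 1 - 2 p\<^sub>x\<close> and \<open>\<zeta> = 1 - 2 p\<^sub>z\<close>.
  It sends the Bloch component \<open>r\<close> along axis \<open>h\<close> to \<open>shift \<xi> \<gamma> u h + contraction \<xi> \<zeta> \<gamma> h * r\<close>.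
\<close>

fun contraction :: "real \<Rightarrow> real \<Rightarrow> real \<Rightarrow> axis \<Rightarrow> real" where
  "contraction \<xi> \<zeta> \<gamma> AxisX = \<zeta> * sqrt (1 - \<gamma>)"
| "contraction \<xi> \<zeta> \<gamma> AxisZ = \<xi> * (1 - \<gamma>)"

fun shift :: "real \<Rightarrow> real \<Rightarrow> real \<Rightarrow> axis \<Rightarrow> real" where
  "shift \<xi> \<gamma> u AxisX = 0"
| "shift \<xi> \<gamma> u AxisZ = \<xi> * \<gamma> * u"

primrec bloch :: "real \<Rightarrow> real \<Rightarrow> real \<Rightarrow> real \<Rightarrow> logical_state \<Rightarrow> nat \<Rightarrow> real" where
  "bloch \<xi> \<zeta> \<gamma> u \<alpha> 0 = sign_of \<alpha>"
| "bloch \<xi> \<zeta> \<gamma> u \<alpha> (Suc N) =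
     shift \<xi> \<gamma> u (axis_of \<alpha>) + contraction \<xi> \<zeta> \<gamma> (axis_of \<alpha>) * bloch \<xi> \<zeta> \<gamma> u \<alpha> N"

text \<open>
  The SPAM parameters are passed as functions \<open>A\<close>, \<open>B\<close> of the axis: an actual component \<open>r\<close>
  along \<open>h\<close> is observed as \<open>A h * r + B h\<close>. They are unrelated to the fit parameters
  \<open>fit_a\<close>, \<open>fit_b\<close>, which are indexed by the initial state.
\<close>

definition observed_error ::
  "real \<Rightarrow> real \<Rightarrow> real \<Rightarrow> real \<Rightarrow> (axis \<Rightarrow> real) \<Rightarrow> (axis \<Rightarrow> real) \<Rightarrow> logical_state \<Rightarrow> nat \<Rightarrow> real" where
  "observed_error \<xi> \<zeta> \<gamma> u A B \<alpha> N =
     (1 - sign_of \<alpha> * (A (axis_of \<alpha>) * bloch \<xi> \<zeta> \<gamma> u \<alpha> N + B (axis_of \<alpha>))) / 2"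

definition fit_eps ::
  "real \<Rightarrow> real \<Rightarrow> real \<Rightarrow> real \<Rightarrow> (axis \<Rightarrow> real) \<Rightarrow> (axis \<Rightarrow> real) \<Rightarrow> logical_state \<Rightarrow> real" where
  "fit_eps \<xi> \<zeta> \<gamma> u A B \<alpha> =
     (let h = axis_of \<alpha>; \<eta> = contraction \<xi> \<zeta> \<gamma> h; t = shift \<xi> \<gamma> u h in
       (1 - \<eta> - sign_of \<alpha> * (A h * t + (1 - \<eta>) * B h)) / 2)"

definition fit_a ::
  "real \<Rightarrow> real \<Rightarrow> real \<Rightarrow> real \<Rightarrow> (axis \<Rightarrow> real) \<Rightarrow> (axis \<Rightarrow> real) \<Rightarrow> logical_state \<Rightarrow> real" where
  "fit_a \<xi> \<zeta> \<gamma> u A B \<alpha> =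
     fit_eps \<xi> \<zeta> \<gamma> u A B \<alpha> / (1 - contraction \<xi> \<zeta> \<gamma> (axis_of \<alpha>))"

definition fit_b ::
  "real \<Rightarrow> real \<Rightarrow> real \<Rightarrow> real \<Rightarrow> (axis \<Rightarrow> real) \<Rightarrow> (axis \<Rightarrow> real) \<Rightarrow> logical_state \<Rightarrow> real" where
  "fit_b \<xi> \<zeta> \<gamma> u A B \<alpha> = observed_error \<xi> \<zeta> \<gamma> u A B \<alpha> 0 - fit_a \<xi> \<zeta> \<gamma> u A B \<alpha>"

end

(* Each cycle acts on the observed error by the affine map p \<mapsto> \<epsilon> + \<eta> * p, whose fixed point
   is a = \<epsilon> / (1 - \<eta>); hence the deviation from a is multiplied by \<eta> = 1 - \<epsilon> / a per cycle. *)

theory Submission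
  imports Defs
begin

text \<open>The observed error is affine in the Bloch component, so it inherits an affine recurrence
  with the same slope; \<open>fit_eps\<close> is exactly the constant left over. Nothing is divided
  by \<open>A h\<close>, so \<open>A h = 0\<close> is covered.\<close>

lemma observed_error_Suc:
  "observed_error \<xi> \<zeta> \<gamma> u A B \<alpha> (Suc N) =
    fit_eps \<xi> \<zeta> \<gamma> u A B \<alpha> + contraction \<xi> \<zeta> \<gamma> (axis_of \<alpha>) * observed_error \<xi> \<zeta> \<gamma> u A B \<alpha> N"
  by (simp add: observed_error_def fit_eps_def Let_def field_simps)

text \<open>Subtracting the fixed point \<open>c\<close> leaves a geometric sequence of ratio
  \<open>q\<close>. Writing the constant term as \<open>(1 - q) * c\<close> avoids division, so any
  commutative ring will do.\<close>

lemma affine_recurrence_closed_form: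
  fixes x :: "nat \<Rightarrow> 'a::comm_ring_1"
  assumes "\<And>n. x (Suc n) = (1 - q) * c + q * x n"
  shows "x n = c + (x 0 - c) * q ^ n"
proof (induction n)
  case (Suc n)
  show ?case by (simp add: assms Suc.IH algebra_simps)
qed simp

lemma sign_of_square: "sign_of \<alpha> * sign_of \<alpha> = 1"
  by (cases \<alpha>) simp_all

lemma shift_unital: "shift \<xi> 0 u h = 0"
  by (cases h) simp_all

theorem mainTheorem2:
  fixes \<xi> \<zeta> \<gamma> u :: real
    and A B :: "axis \<Rightarrow> real"
    and \<alpha> :: logical_state
    and h :: axis
    and p :: "nat \<Rightarrow> real"
    and \<epsilon> a b :: real
  assumes "\<xi> \<in> {-1..1}" and "\<zeta> \<in> {-1..1}" and "\<gamma> \<in> {0..1}" and "u \<in> {-1..1}"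
    and "h = axis_of \<alpha>"
    and "p = observed_error \<xi> \<zeta> \<gamma> u A B \<alpha>"
    and "contraction \<xi> \<zeta> \<gamma> h \<noteq> 1"
    and "\<epsilon> = fit_eps \<xi> \<zeta> \<gamma> u A B \<alpha>"
    and "a = fit_a \<xi> \<zeta> \<gamma> u A B \<alpha>"
    and "b = fit_b \<xi> \<zeta> \<gamma> u A B \<alpha>"
    and "a \<noteq> 0"
  shows "(\<forall>N. p N = a + b * (1 - \<epsilon> / a) ^ N) \<and>
    (A h = 1 \<and> B h = 0 \<longrightarrow>
      b = - a \<and> (\<forall>N. p N = a * (1 - (1 - \<epsilon> / a) ^ N))) \<and>
    (A h = 1 \<and> B h = 0 \<and> \<gamma> = 0 \<longrightarrow>
      a = 1 / 2 \<and> (\<forall>N. p N = 1 / 2 * (1 - (1 - 2 * \<epsilon>) ^ N)))"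
proof -
  define \<eta> where "\<eta> = contraction \<xi> \<zeta> \<gamma> h"
  have \<eta>: "1 - \<eta> \<noteq> 0" using assms(7) by (simp add: \<eta>_def)
  have a: "a = \<epsilon> / (1 - \<eta>)" by (simp only: assms(5,8,9) fit_a_def \<eta>_def)
  \<comment> \<open>This puts the recurrence for \<open>p\<close> into fixed-point form and, as
    \<open>a\<close> is nonzero, identifies the decay rate below.\<close>
  have \<epsilon>: "\<epsilon> = (1 - \<eta>) * a" unfolding a using \<eta> by simp
  have rate: "1 - \<epsilon> / a = \<eta>" unfolding \<epsilon> using \<open>a \<noteq> 0\<close> by simp
  have "p (Suc N) = (1 - \<eta>) * a + \<eta> * p N" for N
    unfolding \<epsilon>[symmetric] by (simp only: assms(5,6,8) \<eta>_def observed_error_Suc)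
  then have closed_form: "p N = a + (p 0 - a) * \<eta> ^ N" for N
    by (rule affine_recurrence_closed_form)
  have b: "b = p 0 - a" by (simp only: assms(6,9,10) fit_b_def)
  have model: "p N = a + b * (1 - \<epsilon> / a) ^ N" for N
    unfolding rate b by (rule closed_form)
  \<comment> \<open>Without SPAM the initial error \<open>p 0\<close> is
    \<open>(1 - s * s) / 2 = 0\<close> for the sign \<open>s\<close> of \<alpha>.\<close>
  have no_spam: "b = - a" if "A h = 1" "B h = 0"
    using that by (simp add: assms(5,9,10) fit_b_def observed_error_def sign_of_square)
  have unital: "a = 1 / 2" if "A h = 1" "B h = 0" "\<gamma> = 0"
  proof -
    \<comment> \<open>For \<gamma> = 0 the shift vanishes on both axes, and \<open>B h = 0\<close>
      removes the other correction to \<epsilon>.\<close>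
    have "\<epsilon> = (1 - \<eta>) / 2"
      using that by (simp add: assms(5,8) fit_eps_def Let_def \<eta>_def shift_unital)
    then show ?thesis unfolding a using \<eta> by simp
  qed
  have no_spam_model: "p N = a * (1 - (1 - \<epsilon> / a) ^ N)" if "A h = 1" "B h = 0" for N
    unfolding model no_spam[OF that] by (simp add: right_diff_distrib)
  \<comment> \<open>With \<open>a = 1 / 2\<close> the quotient \<open>\<epsilon> / a\<close> becomes
    \<open>2 * \<epsilon>\<close>.\<close>
  have unital_model: "p N = 1 / 2 * (1 - (1 - 2 * \<epsilon>) ^ N)" if "A h = 1" "B h = 0" "\<gamma> = 0" for N
    unfolding no_spam_model[OF that(1,2)] unital[OF that] by (simp add: mult.commute)
  show ?thesis
    by (intro conjI impI allI; (elim conjE)?)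
      (rule model no_spam unital no_spam_model unital_model; assumption)+
qed

end
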